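(* Let $n,m\ge 5$ be integers with $m\equiv 1\pmod 4$ and $n\equiv 1\pmod 4$. Then $\gamma_t(C_n\times C_m)\le\frac{(n+1)(m+1)}{4}$ and $\gamma_p(C_n\times C_m)\le\frac{(n+1)(m+1)}{4}+1$.
   Context: All graphs are finite, simple and undirected. $C_n$ denotes the cycle of order $n$ and $G\times H$ the Cartesian product of graphs. For a graph $G$ without isolated vertices: a set $D\subseteq V(G)$ is a total dominating set if every vertex of $G$ (including those in $D$) has a neighbour in $D$; $\gamma_t(G)$ is the minimum size of a total dominating set. A set $D\subseteq V(G)$ is a paired dominating set if every vertex outside $D$ has a neighbour in $D$ and the induced subgraph $G[D]$ has a perfect matching; $\gamma_p(G)$ is the minimum size of a paired dominating set. *)

theory Defs
  imports Complex_Main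
begin

text \<open>A finite simple graph is given by a vertex set V and a symmetric,
irreflexive adjacency predicate E (only its restriction to V matters).\<close>

definition cycle_adj :: "nat \<Rightarrow> nat \<Rightarrow> nat \<Rightarrow> bool" where
  "cycle_adj n i j \<longleftrightarrow> i < n \<and> j < n \<and> i \<noteq> j \<and> (j = (i + 1) mod n \<or> i = (j + 1) mod n)"

definition cycle_verts :: "nat \<Rightarrow> nat set" where
  "cycle_verts n = {0..<n}"

definition cart_verts :: "'a set \<Rightarrow> 'b set \<Rightarrow> ('a \<times> 'b) set" where
  "cart_verts V1 V2 = V1 \<times> V2"

definition cart_adj :: "('a \<Rightarrow> 'a \<Rightarrow> bool) \<Rightarrow> ('b \<Rightarrow> 'b \<Rightarrow> bool) \<Rightarrow> ('a \<times> 'b) \<Rightarrow> ('a \<times> 'b) \<Rightarrow> bool" where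
  "cart_adj E1 E2 x y \<longleftrightarrow>
     (fst x = fst y \<and> E2 (snd x) (snd y)) \<or> (snd x = snd y \<and> E1 (fst x) (fst y))"

definition is_total_dom_set :: "'a set \<Rightarrow> ('a \<Rightarrow> 'a \<Rightarrow> bool) \<Rightarrow> 'a set \<Rightarrow> bool" where
  "is_total_dom_set V E D \<longleftrightarrow> D \<subseteq> V \<and> (\<forall>v\<in>V. \<exists>u\<in>D. E v u)"

definition has_perfect_matching_on :: "('a \<Rightarrow> 'a \<Rightarrow> bool) \<Rightarrow> 'a set \<Rightarrow> bool" where
  "has_perfect_matching_on E D \<longleftrightarrow>
     (\<exists>M :: 'a set set. (\<forall>e\<in>M. \<exists>u v. e = {u, v} \<and> u \<in> D \<and> v \<in> D \<and> u \<noteq> v \<and> E u v)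
        \<and> (\<forall>v\<in>D. \<exists>!e. e \<in> M \<and> v \<in> e))"

definition is_paired_dom_set :: "'a set \<Rightarrow> ('a \<Rightarrow> 'a \<Rightarrow> bool) \<Rightarrow> 'a set \<Rightarrow> bool" where
  "is_paired_dom_set V E D \<longleftrightarrow> D \<subseteq> V \<and> (\<forall>v\<in>V - D. \<exists>u\<in>D. E v u)
      \<and> has_perfect_matching_on E D"

definition gamma_t :: "'a set \<Rightarrow> ('a \<Rightarrow> 'a \<Rightarrow> bool) \<Rightarrow> nat" where
  "gamma_t V E = (LEAST k. \<exists>D. is_total_dom_set V E D \<and> card D = k)"

definition gamma_p :: "'a set \<Rightarrow> ('a \<Rightarrow> 'a \<Rightarrow> bool) \<Rightarrow> nat" where
  "gamma_p V E = (LEAST k. \<exists>D. is_paired_dom_set V E D \<and> card D = k)"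

end

theory Submission
  imports Defs
begin

text \<open>Being a total or a paired dominating set is a condition on the neighbourhood of each vertex,
  so it is inherited under a local isomorphism from a large torus to a small one. A finite table
  whose rows and columns repeat at the right places admits such maps, which insert further copies of
  its first \<open>P\<close> rows or columns. The density of the inserted copies matches the growth of the two
  bounds; hence one table with \<open>P = 4\<close> settles total domination, and three tables with \<open>P = 8\<close>
  settle paired domination, one for each pair of residues modulo 8 up to reflection.\<close>

section \<open>Neighbours on a cycle, and labellings of the torus\<close>

definition nx :: "nat \<Rightarrow> nat \<Rightarrow> nat" where
  "nx n i = (if Suc i = n then 0 else Suc i)"

definition pv :: "nat \<Rightarrow> nat \<Rightarrow> nat" where
  "pv n i = (if i = 0 then n - 1 else i - 1)"

lemma nx_less: "i < n \<Longrightarrow> nx n i < n"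
  by (auto simp: nx_def)

lemma pv_less: "i < n \<Longrightarrow> pv n i < n"
  by (auto simp: pv_def)

lemma pv_nx: "i < n \<Longrightarrow> pv n (nx n i) = i"
  by (auto simp: nx_def pv_def)

lemma nx_pv: "i < n \<Longrightarrow> nx n (pv n i) = i"
  by (auto simp: nx_def pv_def)

lemma cycle_adj_nx:
  assumes "i < n" "1 < n"
  shows "cycle_adj n i (nx n i)"
  using assms by (auto simp: cycle_adj_def nx_def)

lemma cycle_adj_pv:
  assumes "i < n" "1 < n"
  shows "cycle_adj n i (pv n i)"
  using assms by (auto simp: cycle_adj_def pv_def)

type_synonym labelling = "nat \<Rightarrow> nat \<Rightarrow> char"

text \<open>A dot marks a vertex that is not selected; the letters u, d, l, r at a selected vertex point
  up, down, left, right to the vertex it is paired with, rows being numbered downwards.\<close>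

definition chosen :: "nat \<Rightarrow> nat \<Rightarrow> labelling \<Rightarrow> (nat \<times> nat) set" where
  "chosen n m f = {(i, j). i < n \<and> j < m \<and> f i j \<noteq> CHR ''.''}"

definition dominating :: "nat \<Rightarrow> nat \<Rightarrow> labelling \<Rightarrow> bool" where
  "dominating n m f \<longleftrightarrow> (\<forall>i<n. \<forall>j<m.
     f (nx n i) j \<noteq> CHR ''.'' \<or> f (pv n i) j \<noteq> CHR ''.'' \<or>
     f i (nx m j) \<noteq> CHR ''.'' \<or> f i (pv m j) \<noteq> CHR ''.'')"

definition matched :: "nat \<Rightarrow> nat \<Rightarrow> labelling \<Rightarrow> bool" where
  "matched n m f \<longleftrightarrow> (\<forall>i<n. \<forall>j<m.
     if f i j = CHR ''u'' then f (pv n i) j = CHR ''d''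
     else if f i j = CHR ''d'' then f (nx n i) j = CHR ''u''
     else if f i j = CHR ''l'' then f i (pv m j) = CHR ''r''
     else if f i j = CHR ''r'' then f i (nx m j) = CHR ''l''
     else f i j = CHR ''.'')"

text \<open>The last branch serves the letter r: in a \<open>matched\<close> labelling a selected
  vertex of the torus carries one of the four direction letters.\<close>

definition partner :: "nat \<Rightarrow> nat \<Rightarrow> labelling \<Rightarrow> nat \<times> nat \<Rightarrow> nat \<times> nat" where
  "partner n m f = (\<lambda>(i, j).
     if f i j = CHR ''u'' then (pv n i, j)
     else if f i j = CHR ''d'' then (nx n i, j)
     else if f i j = CHR ''l'' then (i, pv m j)
     else (i, nx m j))"

abbreviation torus_verts :: "nat \<Rightarrow> nat \<Rightarrow> (nat \<times> nat) set" where
  "torus_verts n m \<equiv> cart_verts (cycle_verts n) (cycle_verts m)"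

abbreviation torus_adj :: "nat \<Rightarrow> nat \<Rightarrow> nat \<times> nat \<Rightarrow> nat \<times> nat \<Rightarrow> bool" where
  "torus_adj n m \<equiv> cart_adj (cycle_adj n) (cycle_adj m)"

lemma dominating_imp_total_dom_set:
  assumes "dominating n m f" "1 < n" "1 < m"
  shows "is_total_dom_set (torus_verts n m) (torus_adj n m) (chosen n m f)"
  unfolding is_total_dom_set_def
proof (intro conjI ballI)
  show "chosen n m f \<subseteq> torus_verts n m"
    by (auto simp: chosen_def cart_verts_def cycle_verts_def)
next
  fix v assume "v \<in> torus_verts n m"
  then obtain i j where v: "v = (i, j)" "i < n" "j < m"
    by (auto simp: cart_verts_def cycle_verts_def)
  have less: "nx n i < n" "pv n i < n" "nx m j < m" "pv m j < m"
    using v by (simp_all add: nx_less pv_less)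
  have adj: "torus_adj n m v (nx n i, j)" "torus_adj n m v (pv n i, j)"
    "torus_adj n m v (i, nx m j)" "torus_adj n m v (i, pv m j)"
    using v assms by (simp_all add: cart_adj_def cycle_adj_nx cycle_adj_pv)
  have "(nx n i, j) \<in> chosen n m f \<or> (pv n i, j) \<in> chosen n m f \<or>
      (i, nx m j) \<in> chosen n m f \<or> (i, pv m j) \<in> chosen n m f"
    using assms(1) v less by (simp add: dominating_def chosen_def)
  then show "\<exists>u\<in>chosen n m f. torus_adj n m v u"
    using adj by blast
qed

lemma partner_chosen:
  assumes "matched n m f" "1 < n" "1 < m" "v \<in> chosen n m f"
  shows "partner n m f v \<in> chosen n m f" "partner n m f (partner n m f v) = v"
    "torus_adj n m v (partner n m f v)"
proof -
  obtain i j where v: "v = (i, j)" "i < n" "j < m" "f i j \<noteq> CHR ''.''"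
    using assms(4) by (auto simp: chosen_def)
  have "if f i j = CHR ''u'' then f (pv n i) j = CHR ''d''
     else if f i j = CHR ''d'' then f (nx n i) j = CHR ''u''
     else if f i j = CHR ''l'' then f i (pv m j) = CHR ''r''
     else if f i j = CHR ''r'' then f i (nx m j) = CHR ''l''
     else f i j = CHR ''.''"
    using assms(1) v(2,3) unfolding matched_def by blast
  with v(4) consider
      "f i j = CHR ''u''" "f (pv n i) j = CHR ''d''"
    | "f i j = CHR ''d''" "f (nx n i) j = CHR ''u''"
    | "f i j = CHR ''l''" "f i (pv m j) = CHR ''r''"
    | "f i j = CHR ''r''" "f i (nx m j) = CHR ''l''"
    by (auto split: if_splits)
  then have "partner n m f v \<in> chosen n m f \<and> partner n m f (partner n m f v) = v \<and>
      torus_adj n m v (partner n m f v)"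
    using assms(2,3) v(1-3)
    by cases (simp_all add: partner_def chosen_def cart_adj_def nx_less pv_less nx_pv pv_nx
        cycle_adj_nx cycle_adj_pv)
  then show "partner n m f v \<in> chosen n m f" "partner n m f (partner n m f v) = v"
    "torus_adj n m v (partner n m f v)"
    by blast+
qed

text \<open>The orbits \<open>{v, p v}\<close> of a fixed-point-free involution partition
  \<open>D\<close> into pairs.\<close>

lemma involution_imp_perfect_matching:
  assumes "\<And>v. v \<in> D \<Longrightarrow> p v \<in> D" "\<And>v. v \<in> D \<Longrightarrow> p (p v) = v"
    "\<And>v. v \<in> D \<Longrightarrow> p v \<noteq> v" "\<And>v. v \<in> D \<Longrightarrow> E v (p v)"
  shows "has_perfect_matching_on E D"
  unfolding has_perfect_matching_on_def
proof (intro exI[of _ "(\<lambda>v. {v, p v}) ` D"] conjI ballI)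
  fix e assume "e \<in> (\<lambda>v. {v, p v}) ` D"
  then obtain v where v: "v \<in> D" "e = {v, p v}"
    by blast
  show "\<exists>u v. e = {u, v} \<and> u \<in> D \<and> v \<in> D \<and> u \<noteq> v \<and> E u v"
    using v assms(1,4)[OF v(1)] assms(3)[OF v(1)]
    by (intro exI[of _ v] exI[of _ "p v"] conjI) auto
next
  fix v assume "v \<in> D"
  show "\<exists>!e. e \<in> (\<lambda>v. {v, p v}) ` D \<and> v \<in> e"
  proof (rule ex1I[of _ "{v, p v}"])
    show "{v, p v} \<in> (\<lambda>v. {v, p v}) ` D \<and> v \<in> {v, p v}"
      using \<open>v \<in> D\<close> by blast
  next
    fix e assume "e \<in> (\<lambda>v. {v, p v}) ` D \<and> v \<in> e"
    then obtain u where u: "u \<in> D" "e = {u, p u}" "v = u \<or> v = p u"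
      by blast
    \<comment> \<open>A pair containing \<open>v\<close> was generated by \<open>v\<close> or by its
      partner, and both generate the same pair.\<close>
    from u(3) show "e = {v, p v}"
    proof
      assume "v = p u"
      then show ?thesis
        using u(2) assms(2)[OF u(1)] by (simp add: insert_commute)
    qed (use u(2) in simp)
  qed
qed

lemma matched_imp_paired_dom_set:
  assumes "dominating n m f" "matched n m f" "1 < n" "1 < m"
  shows "is_paired_dom_set (torus_verts n m) (torus_adj n m) (chosen n m f)"
proof -
  \<comment> \<open>Rules out fixed points of \<open>partner\<close>, since a selected vertex is
    adjacent to its partner.\<close>
  have irrefl: "\<not> torus_adj n m v v" for v
    by (auto simp: cart_adj_def cycle_adj_def)
  have "has_perfect_matching_on (torus_adj n m) (chosen n m f)"
    by (rule involution_imp_perfect_matching[where p = "partner n m f"])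
      (use partner_chosen[OF assms(2-4)] irrefl in force)+
  then show ?thesis
    using dominating_imp_total_dom_set[OF assms(1,3,4)]
    by (auto simp: is_paired_dom_set_def is_total_dom_set_def)
qed

lemma gamma_t_le:
  assumes "is_total_dom_set V E D"
  shows "gamma_t V E \<le> card D"
  unfolding gamma_t_def by (rule Least_le) (use assms in blast)

lemma gamma_p_le:
  assumes "is_paired_dom_set V E D"
  shows "gamma_p V E \<le> card D"
  unfolding gamma_p_def by (rule Least_le) (use assms in blast)

section \<open>Exchanging the two factors\<close>

definition reflect :: "labelling \<Rightarrow> labelling" where
  "reflect f = (\<lambda>i j.
     if f j i = CHR ''u'' then CHR ''l''
     else if f j i = CHR ''l'' then CHR ''u''
     else if f j i = CHR ''d'' then CHR ''r''
     else if f j i = CHR ''r'' then CHR ''d''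
     else f j i)"

lemma reflect_eq_dot: "reflect f i j = CHR ''.'' \<longleftrightarrow> f j i = CHR ''.''"
  by (simp add: reflect_def)

lemma dominating_reflect: "dominating n m f \<Longrightarrow> dominating m n (reflect f)"
  unfolding dominating_def reflect_eq_dot by blast

text \<open>Transposition turns up into left and down into right, which is why
  \<open>reflect\<close> swaps letters as well as coordinates.\<close>

lemma matched_reflect:
  assumes "matched n m f"
  shows "matched m n (reflect f)"
  unfolding matched_def
proof (intro allI impI)
  fix i j assume "i < m" "j < n"
  then have "if f j i = CHR ''u'' then f (pv n j) i = CHR ''d''
     else if f j i = CHR ''d'' then f (nx n j) i = CHR ''u''
     else if f j i = CHR ''l'' then f j (pv m i) = CHR ''r''
     else if f j i = CHR ''r'' then f j (nx m i) = CHR ''l''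
     else f j i = CHR ''.''"
    using assms unfolding matched_def by blast
  then show "if reflect f i j = CHR ''u'' then reflect f (pv m i) j = CHR ''d''
     else if reflect f i j = CHR ''d'' then reflect f (nx m i) j = CHR ''u''
     else if reflect f i j = CHR ''l'' then reflect f i (pv n j) = CHR ''r''
     else if reflect f i j = CHR ''r'' then reflect f i (nx n j) = CHR ''l''
     else reflect f i j = CHR ''.''"
    by (simp add: reflect_def split: if_splits)
qed

lemma card_chosen_reflect: "card (chosen m n (reflect f)) = card (chosen n m f)"
proof -
  have "chosen m n (reflect f) = prod.swap ` chosen n m f"
    by (auto simp: chosen_def reflect_eq_dot)
  then show ?thesis
    by (simp add: card_image)
qed

section \<open>Weights of blocks, and winding along a cycle\<close>

definition weight :: "nat set \<Rightarrow> nat set \<Rightarrow> labelling \<Rightarrow> nat" where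
  "weight I J f = (\<Sum>i\<in>I. \<Sum>j\<in>J. of_bool (f i j \<noteq> CHR ''.''))"

lemma card_chosen: "card (chosen n m f) = weight {0..<n} {0..<m} f"
proof -
  have "chosen n m f = Sigma {0..<n} (\<lambda>i. {0..<m} \<inter> {j. f i j \<noteq> CHR ''.''})"
    by (auto simp: chosen_def)
  then show ?thesis
    by (simp add: weight_def)
qed

text \<open>The winding map sends the cycle of length \<open>p * P + k\<close> to the one of length \<open>P + k\<close> by
  running \<open>p\<close> times through the first \<open>P\<close> vertices and once through the others.\<close>

definition wind :: "nat \<Rightarrow> nat \<Rightarrow> nat \<Rightarrow> nat" where
  "wind P p i = (if i < p * P then i mod P else i - p * P + P)"

lemma wind_less:
  assumes "0 < P" "i < p * P + k"
  shows "wind P p i < P + k"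
  using assms by (auto simp: wind_def trans_less_add1)

text \<open>\<open>wind\<close> commutes with the successor except after a pass that is not the
  last, where it gives 0 in place of \<open>P\<close>, and, if \<open>p = 0\<close>, at the
  wrap-around, where it gives \<open>P\<close> in place of 0. The function \<open>g\<close> does not
  see the difference.\<close>

lemma wind_nx:
  assumes "g P = g 0" "0 < P" "0 < k" "i < p * P + k"
  shows "g (wind P p (nx (p * P + k) i)) = g (nx (P + k) (wind P p i))"
proof (cases "Suc i < p * P")
  case True
  \<comment> \<open>As \<open>k > 0\<close>, the last index of the periodic block is not the end of
    the short cycle, so \<open>nx\<close> does not wrap there.\<close>
  moreover have "Suc (i mod P) \<noteq> P + k"
    using assms(2,3) mod_less_divisor[of P i] by linarith
  ultimately show ?thesis
    using assms by (auto simp: wind_def nx_def mod_Suc)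
next
  case False
  show ?thesis
  proof (cases "Suc i = p * P")
    case True
    then have "Suc (i mod P) = P"
      using assms(2) by (metis mod_Suc mod_mult_self2_is_0 nat.distinct(1))
    with True show ?thesis
      using assms by (auto simp: wind_def nx_def)
  next
    case ne: False
    with False obtain d where "i = p * P + d"
      by (metis less_Suc_eq linorder_not_less nat_le_iff_add not_less_eq)
    then show ?thesis
      using assms by (auto simp: wind_def nx_def add.commute)
  qed
qed

text \<open>At the start of a later pass the long cycle steps back to \<open>P - 1\<close>, the
  short one from 0 to \<open>P + k - 1\<close>; for \<open>p = 0\<close> and \<open>i = 0\<close> it
  is the other way round. The second equation on \<open>g\<close> identifies the two.\<close>

lemma wind_pv:
  assumes "g P = g 0" "g (P + k - 1) = g (P - 1)" "0 < P" "0 < k" "i < p * P + k"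
  shows "g (wind P p (pv (p * P + k) i)) = g (pv (P + k) (wind P p i))"
proof (cases "i = 0")
  case True
  moreover have "g (k + P - Suc 0) = g (P - Suc 0)"
    using assms(2) by (simp add: add.commute)
  ultimately show ?thesis
    using assms by (cases "p = 0") (auto simp: wind_def pv_def)
next
  case False
  then obtain h where h: "i = Suc h" by (cases i) auto
  show ?thesis
  proof (cases "i < p * P")
    case True
    moreover have "h mod P = P - 1" if "Suc (h mod P) = P"
      using that by simp
    ultimately show ?thesis
      using assms h by (auto simp: wind_def pv_def mod_Suc)
  next
    case ge: False
    show ?thesis
    proof (cases "i = p * P")
      case True
      then have "Suc (h mod P) = P"
        using assms(3) h by (metis mod_Suc mod_mult_self2_is_0 nat.distinct(1))
      then have "(p * P - 1) mod P = P - 1"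
        using True h by (metis diff_Suc_1)
      with True show ?thesis
        using assms h by (auto simp: wind_def pv_def)
    next
      case ne: False
      with ge show ?thesis
        using assms h by (auto simp: wind_def pv_def Suc_diff_le)
    qed
  qed
qed

lemma sum_wind:
  fixes g :: "nat \<Rightarrow> nat"
  assumes "0 < P"
  shows "(\<Sum>i = 0..<p * P + k. g (wind P p i)) = p * (\<Sum>i = 0..<P. g i) + (\<Sum>i = P..<P + k. g i)"
proof -
  have periodic: "(\<Sum>i = 0..<p * P. g (i mod P)) = p * (\<Sum>i = 0..<P. g i)"
  proof (induction p)
    case (Suc p)
    have "(\<Sum>i = p * P..<p * P + P. g (i mod P)) = (\<Sum>i = 0..<P. g i)"
      using sum.shift_bounds_nat_ivl[of "\<lambda>i. g (i mod P)" 0 "p * P" P] by (simp add: add.commute)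
    then show ?case
      using Suc sum.atLeastLessThan_concat[of 0 "p * P" "p * P + P" "\<lambda>i. g (i mod P)"]
      by (simp add: add.commute)
  qed simp
  have "(\<Sum>i = 0..<p * P + k. g (wind P p i)) =
      (\<Sum>i = 0..<p * P. g (wind P p i)) + (\<Sum>i = p * P..<p * P + k. g (wind P p i))"
    by (simp add: sum.atLeastLessThan_concat)
  moreover have "(\<Sum>i = p * P..<p * P + k. g (wind P p i)) = (\<Sum>i = P..<P + k. g i)"
    by (rule sum.reindex_bij_witness[of _ "\<lambda>i. i - P + p * P" "wind P p"]) (auto simp: wind_def)
  moreover have "(\<Sum>i = 0..<p * P. g (wind P p i)) = (\<Sum>i = 0..<p * P. g (i mod P))"
    by (simp add: wind_def)
  ultimately show ?thesis
    using periodic by simp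
qed

text \<open>The value \<open>p = 0\<close> drops the periodic rows altogether; this is how the
  shortest cycles, of length 5 or 9, are reached.\<close>

definition unroll :: "nat \<Rightarrow> nat \<Rightarrow> nat \<Rightarrow> labelling \<Rightarrow> labelling" where
  "unroll P p q f = (\<lambda>i j. f (wind P p i) (wind P q j))"

text \<open>By \<open>sum_wind\<close> for columns and then rows, the four blocks of the table recur
  \<open>p * q\<close>, \<open>p\<close>, \<open>q\<close> and 1 times.\<close>

lemma weight_unroll:
  assumes "0 < P"
  shows "weight {0..<p * P + k} {0..<q * P + l} (unroll P p q f) =
    p * (q * weight {0..<P} {0..<P} f + weight {0..<P} {P..<P + l} f) +
    (q * weight {P..<P + k} {0..<P} f + weight {P..<P + k} {P..<P + l} f)"
proof -
  define h :: "nat \<Rightarrow> nat \<Rightarrow> nat" where "h i j = of_bool (f i j \<noteq> CHR ''.'')" for i j :: nat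
  have weight: "weight I J f = (\<Sum>i\<in>I. sum (h i) J)" for I J
    by (simp add: weight_def h_def)
  have "weight {0..<p * P + k} {0..<q * P + l} (unroll P p q f) =
      (\<Sum>i = 0..<p * P + k. q * sum (h (wind P p i)) {0..<P} + sum (h (wind P p i)) {P..<P + l})"
    unfolding weight_def unroll_def h_def[symmetric] using sum_wind[OF assms, of "h _"] by simp
  then show ?thesis
    using sum_wind[OF assms, of "\<lambda>i. q * sum (h i) {0..<P} + sum (h i) {P..<P + l}"]
    by (simp add: weight sum.distrib sum_distrib_left)
qed

section \<open>Tables with seams\<close>

definition cell :: "string list \<Rightarrow> labelling" where
  "cell T i j = T ! i ! j"

text \<open>Equal rows on both sides of the two seams are what makes the winding map preserve the labels
  of all neighbours.\<close>

definition seamed :: "nat \<Rightarrow> nat \<Rightarrow> nat \<Rightarrow> string list \<Rightarrow> bool" where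
  "seamed P k l T \<longleftrightarrow> 0 < P \<and> 0 < k \<and> 0 < l \<and> length T = P + k \<and>
     T ! P = hd T \<and> last T = T ! (P - 1) \<and>
     (\<forall>r\<in>set T. length r = P + l \<and> r ! P = hd r \<and> last r = r ! (P - 1))"

lemma seamed_cell:
  assumes "seamed P k l T"
  shows "0 < P" "0 < k" "0 < l"
    "cell T P = cell T 0" "cell T (P + k - 1) = cell T (P - 1)"
    "i < P + k \<Longrightarrow> cell T i P = cell T i 0"
    "i < P + k \<Longrightarrow> cell T i (P + l - 1) = cell T i (P - 1)"
proof -
  show "0 < P" "0 < k" "0 < l"
    using assms by (simp_all add: seamed_def)
  have ne: "T \<noteq> []" "length T = P + k"
    using assms by (auto simp: seamed_def)
  show "cell T P = cell T 0" "cell T (P + k - 1) = cell T (P - 1)"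
    using assms ne by (auto simp: seamed_def cell_def fun_eq_iff hd_conv_nth last_conv_nth)
  assume "i < P + k"
  then have "T ! i \<in> set T" using ne by simp
  then have *: "length (T ! i) = P + l" "T ! i ! P = hd (T ! i)" "last (T ! i) = T ! i ! (P - 1)"
    using assms by (auto simp: seamed_def)
  moreover have "T ! i \<noteq> []"
    using * \<open>0 < P\<close> by auto
  ultimately show "cell T i P = cell T i 0" "cell T i (P + l - 1) = cell T i (P - 1)"
    by (simp_all add: cell_def hd_conv_nth last_conv_nth)
qed

text \<open>This is the local isomorphism. Vertical moves use the winding lemmas with whole rows as
  values (\<open>g = cell T\<close>), horizontal moves use them inside one row
  (\<open>g = cell T r\<close>).\<close>

lemma unroll_neighbours:
  assumes "seamed P k l T" "i < p * P + k" "j < q * P + l"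
  defines "F \<equiv> unroll P p q (cell T)" and "r \<equiv> wind P p i" and "c \<equiv> wind P q j"
  shows "r < P + k" "c < P + l" "F i j = cell T r c"
    "F (nx (p * P + k) i) j = cell T (nx (P + k) r) c"
    "F (pv (p * P + k) i) j = cell T (pv (P + k) r) c"
    "F i (nx (q * P + l) j) = cell T r (nx (P + l) c)"
    "F i (pv (q * P + l) j) = cell T r (pv (P + l) c)"
proof -
  note S = seamed_cell[OF assms(1)]
  show "r < P + k" "c < P + l"
    unfolding r_def c_def using S(1) assms(2,3) by (simp_all add: wind_less)
  note S' = S(6,7)[OF \<open>r < P + k\<close>]
  show "F i j = cell T r c"
    by (simp add: F_def unroll_def r_def c_def)
  show "F (nx (p * P + k) i) j = cell T (nx (P + k) r) c"
    using wind_nx[of "cell T", OF S(4,1,2) assms(2)] by (simp add: F_def unroll_def r_def c_def)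
  show "F (pv (p * P + k) i) j = cell T (pv (P + k) r) c"
    using wind_pv[of "cell T", OF S(4,5,1,2) assms(2)] by (simp add: F_def unroll_def r_def c_def)
  show "F i (nx (q * P + l) j) = cell T r (nx (P + l) c)"
    using wind_nx[of "cell T r", OF S'(1) S(1,3) assms(3)] by (simp add: F_def unroll_def r_def c_def)
  show "F i (pv (q * P + l) j) = cell T r (pv (P + l) c)"
    using wind_pv[of "cell T r", OF S' S(1,3) assms(3)] by (simp add: F_def unroll_def r_def c_def)
qed

text \<open>The condition at a vertex reads only labels that \<open>unroll_neighbours\<close>
  identifies with labels of the table.\<close>

lemma dominating_unroll:
  assumes "seamed P k l T" "dominating (P + k) (P + l) (cell T)"
  shows "dominating (p * P + k) (q * P + l) (unroll P p q (cell T))"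
  using assms(2) unroll_neighbours[OF assms(1)] by (simp add: dominating_def)

lemma matched_unroll:
  assumes "seamed P k l T" "matched (P + k) (P + l) (cell T)"
  shows "matched (p * P + k) (q * P + l) (unroll P p q (cell T))"
  using assms(2) unroll_neighbours[OF assms(1)] by (simp add: matched_def)

text \<open>The digits in the names of the paired tables are the lengths left over after the periodic
  first 8 rows and columns; these tables were found with a SAT solver.\<close>

definition tab99 :: "string list" where
  "tab99 =
   [''.....rl.......rl.'',
    ''.rl......rl......'',
    ''....d..d....rl..d'',
    ''....u..u....rl..u'',
    ''.rl......rl......'',
    ''.....rl.......rl.'',
    ''d..d....d..dd....'',
    ''u..u....u..uu....'',
    ''.....rl.......rl.'',
    ''.rl..rl..drl..rl.'',
    ''.rl......u.......'',
    ''....d..d...rld..d'',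
    ''....u..u...rlu..u'',
    ''.rl......d.......'',
    ''.....rl..u....rl.'',
    ''d..d....d..dd....'',
    ''u..u....u..uu....'']"

definition tab59 :: "string list" where
  "tab59 =
   [''rl......rl.......'',
    ''...d..d....d..rl.'',
    ''...u..u....u..rl.'',
    ''rl......rl.......'',
    ''....rl......rl...'',
    ''..d....d..d....dd'',
    ''..u....u..u....uu'',
    ''....rl......rl...'',
    ''rl......rl.......'',
    ''...rl.d....rldrl.'',
    ''......u...d..u.d.'',
    ''lrl....rl.u....ur'',
    ''....rl......rl...'']"

definition tab55 :: "string list" where
  "tab55 =
   [''...u..u....u.'',
    ''rl......rl...'',
    ''....rl...rl..'',
    ''..d....d....d'',
    ''..u....u....u'',
    ''....rl...rl..'',
    ''rl......rl...'',
    ''...d..d....d.'',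
    ''...u..u....u.'',
    ''rl......rl...'',
    ''d...rl..dd...'',
    ''url.....uurl.'',
    ''...d..d....d.'']"

text \<open>Total domination involves no pairing, so \<open>#\<close> merely stands for a label
  other than the dot.\<close>

definition tab_total :: "string list" where
  "tab_total =
   [''.........'',
    ''.##..###.'',
    ''.........'',
    ''#..##..##'',
    ''.........'',
    ''.##..###.'',
    ''.........'',
    ''#..##..##'',
    ''#..##..##'']"

section \<open>Verification of the tables\<close>

lemma tab_total_dominating: "dominating 9 9 (cell tab_total)"
  by code_simp

lemma tab_total_seamed: "seamed 4 5 5 tab_total"
  by code_simp

text \<open>These are the coefficients of (2p+3)(2q+3) = 4pq + 6p + 6q + 9, so the count equals the
  bound for all p and q.\<close>

lemma tab_total_weight:
  "weight {0..<4} {0..<4} (cell tab_total) = 4"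
  "weight {0..<4} {4..<9} (cell tab_total) = 6"
  "weight {4..<9} {0..<4} (cell tab_total) = 6"
  "weight {4..<9} {4..<9} (cell tab_total) = 9"
  by code_simp+

lemma tab55_dominating: "dominating 13 13 (cell tab55)"
  by code_simp

lemma tab55_matched: "matched 13 13 (cell tab55)"
  by code_simp

lemma tab55_seamed: "seamed 8 5 5 tab55"
  by code_simp

text \<open>Four times the resulting count is exactly (8p+6)(8q+6) + 4. The corner block has 10
  instead of 36/4 = 9: (n+1)(m+1)/4 is odd, whereas a perfectly matched set is even. Likewise the
  corners of \<open>tab59\<close> and \<open>tab99\<close> have 16 and 26 instead of 15 and
  25.\<close>

lemma tab55_weight:
  "weight {0..<8} {0..<8} (cell tab55) = 16"
  "weight {0..<8} {8..<13} (cell tab55) = 12"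
  "weight {8..<13} {0..<8} (cell tab55) = 12"
  "weight {8..<13} {8..<13} (cell tab55) = 10"
  by code_simp+

lemma tab59_dominating: "dominating 13 17 (cell tab59)"
  by code_simp

lemma tab59_matched: "matched 13 17 (cell tab59)"
  by code_simp

lemma tab59_seamed: "seamed 8 5 9 tab59"
  by code_simp

lemma tab59_weight:
  "weight {0..<8} {0..<8} (cell tab59) = 16"
  "weight {0..<8} {8..<17} (cell tab59) = 20"
  "weight {8..<13} {0..<8} (cell tab59) = 12"
  "weight {8..<13} {8..<17} (cell tab59) = 16"
  by code_simp+

lemma tab99_dominating: "dominating 17 17 (cell tab99)"
  by code_simp

lemma tab99_matched: "matched 17 17 (cell tab99)"
  by code_simp

lemma tab99_seamed: "seamed 8 9 9 tab99"
  by code_simp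

lemma tab99_weight:
  "weight {0..<8} {0..<8} (cell tab99) = 16"
  "weight {0..<8} {8..<17} (cell tab99) = 20"
  "weight {8..<17} {0..<8} (cell tab99) = 20"
  "weight {8..<17} {8..<17} (cell tab99) = 26"
  by code_simp+

section \<open>The two bounds\<close>

lemma gamma_t_torus_le:
  "gamma_t (torus_verts (4 * p + 5) (4 * q + 5)) (torus_adj (4 * p + 5) (4 * q + 5))
    \<le> (2 * p + 3) * (2 * q + 3)"
proof -
  let ?f = "unroll 4 p q (cell tab_total)"
  have "dominating (p * 4 + 5) (q * 4 + 5) ?f"
    using dominating_unroll[OF tab_total_seamed] tab_total_dominating by simp
  then have "gamma_t (torus_verts (p * 4 + 5) (q * 4 + 5)) (torus_adj (p * 4 + 5) (q * 4 + 5))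
      \<le> weight {0..<p * 4 + 5} {0..<q * 4 + 5} ?f"
    unfolding card_chosen[symmetric]
    by (intro gamma_t_le dominating_imp_total_dom_set) simp_all
  also have "\<dots> = (2 * p + 3) * (2 * q + 3)"
    using weight_unroll[of 4 p 5 q 5 "cell tab_total"] tab_total_weight by (simp add: algebra_simps)
  finally show ?thesis
    by (simp add: mult.commute)
qed

lemma ex_paired_labelling:
  assumes "n mod 4 = 1" "m mod 4 = 1" "5 \<le> n" "5 \<le> m"
  shows "\<exists>f. dominating n m f \<and> matched n m f \<and> 4 * card (chosen n m f) \<le> (n + 1) * (m + 1) + 4"
proof -
  \<comment> \<open>The residue 1 modulo 8 is represented by 9, the smallest such length that is at
    least 5.\<close>
  have split: "\<exists>p. x = p * 8 + 5 \<or> x = p * 8 + 9" if "x mod 4 = 1" "5 \<le> x" for x :: nat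
    using that by presburger
  \<comment> \<open>Reduces each residue case to a checked table and one polynomial inequality in
    \<open>p\<close> and \<open>q\<close>, its left side coming from
    \<open>weight_unroll\<close>.\<close>
  have main: "\<exists>f. dominating n m f \<and> matched n m f \<and> 4 * card (chosen n m f) \<le> (n + 1) * (m + 1) + 4"
    if "seamed 8 k l T" "dominating (8 + k) (8 + l) (cell T)" "matched (8 + k) (8 + l) (cell T)"
      "n = p * 8 + k" "m = q * 8 + l"
      "4 * (p * (q * weight {0..<8} {0..<8} (cell T) + weight {0..<8} {8..<8 + l} (cell T)) +
        (q * weight {8..<8 + k} {0..<8} (cell T) + weight {8..<8 + k} {8..<8 + l} (cell T)))
        \<le> (n + 1) * (m + 1) + 4"
    for n m k l p q T
    using that dominating_unroll[OF that(1,2)] matched_unroll[OF that(1,3)]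
    by (intro exI[of _ "unroll 8 p q (cell T)"]) (simp add: card_chosen weight_unroll)
  \<comment> \<open>Stated for arbitrary \<open>n\<close> and \<open>m\<close>, so that the opposite
    mixed case can use it with the factors exchanged and then apply \<open>reflect\<close>.\<close>
  have 59: "\<exists>f. dominating n m f \<and> matched n m f \<and> 4 * card (chosen n m f) \<le> (n + 1) * (m + 1) + 4"
    if "n = p * 8 + 5" "m = q * 8 + 9" for n m p q
    by (rule main[OF tab59_seamed _ _ that])
      (use tab59_dominating tab59_matched tab59_weight that in \<open>simp_all add: algebra_simps\<close>)
  from split[OF assms(1,3)] split[OF assms(2,4)] obtain p q where
    "n = p * 8 + 5 \<or> n = p * 8 + 9" "m = q * 8 + 5 \<or> m = q * 8 + 9"
    by blast
  then consider "n = p * 8 + 5" "m = q * 8 + 5" | "n = p * 8 + 5" "m = q * 8 + 9"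
    | "n = p * 8 + 9" "m = q * 8 + 5" | "n = p * 8 + 9" "m = q * 8 + 9"
    by blast
  then show ?thesis
  proof cases
    case 1
    show ?thesis
      by (rule main[OF tab55_seamed _ _ 1])
        (use tab55_dominating tab55_matched tab55_weight 1 in \<open>simp_all add: algebra_simps\<close>)
  next
    case 2
    then show ?thesis by (rule 59)
  next
    case 3
    from 59[OF 3(2,1)] obtain f where "dominating m n f" "matched m n f"
      "4 * card (chosen m n f) \<le> (m + 1) * (n + 1) + 4"
      by blast
    then show ?thesis
      by (intro exI[of _ "reflect f"])
        (simp add: dominating_reflect matched_reflect card_chosen_reflect mult.commute)
  next
    case 4
    show ?thesis
      by (rule main[OF tab99_seamed _ _ 4])
        (use tab99_dominating tab99_matched tab99_weight 4 in \<open>simp_all add: algebra_simps\<close>)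
  qed
qed

theorem theorem5p3:
  fixes n m :: nat
  assumes "n \<ge> 5" and "m \<ge> 5" and "n mod 4 = 1" and "m mod 4 = 1"
  shows "real (gamma_t (cart_verts (cycle_verts n) (cycle_verts m)) (cart_adj (cycle_adj n) (cycle_adj m)))
           \<le> real ((n + 1) * (m + 1)) / 4
       \<and> real (gamma_p (cart_verts (cycle_verts n) (cycle_verts m)) (cart_adj (cycle_adj n) (cycle_adj m)))
           \<le> real ((n + 1) * (m + 1)) / 4 + 1"
proof
  have split: "\<exists>p. x = 4 * p + 5" if "x mod 4 = 1" "5 \<le> x" for x :: nat
    using that by presburger
  obtain p q where pq: "n = 4 * p + 5" "m = 4 * q + 5"
    using split assms by metis
  have "4 * gamma_t (torus_verts n m) (torus_adj n m) \<le> 4 * ((2 * p + 3) * (2 * q + 3))"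
    using gamma_t_torus_le[of p q] pq by simp
  also have "\<dots> = (n + 1) * (m + 1)"
    using pq by (simp add: algebra_simps)
  finally show "real (gamma_t (torus_verts n m) (torus_adj n m)) \<le> real ((n + 1) * (m + 1)) / 4"
    by linarith
next
  obtain f where f: "dominating n m f" "matched n m f"
    "4 * card (chosen n m f) \<le> (n + 1) * (m + 1) + 4"
    using ex_paired_labelling assms by blast
  have "gamma_p (torus_verts n m) (torus_adj n m) \<le> card (chosen n m f)"
    using f assms by (intro gamma_p_le matched_imp_paired_dom_set) simp_all
  with f(3) show "real (gamma_p (torus_verts n m) (torus_adj n m)) \<le> real ((n + 1) * (m + 1)) / 4 + 1"
    by linarith
qed

end
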